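(* Let $M\in\mathbb{R}^{2n\times 2n}$ be symmetric positive-definite with $q\le n$ distinct symplectic eigenvalues $d_1<\dots<d_q$ of multiplicities $m_1,\dots,m_q$, respectively, and let $S\in\mathrm{Sp}(2n)$ be a symplectically diagonalizing matrix of $M$. Then a matrix $T\in\mathrm{Sp}(2n)$ symplectically diagonalizes $M$ if and only if there exists $K\in\mathrm{dab}\bigl(\mathrm{OrSp}(2m_1)\times\cdots\times\mathrm{OrSp}(2m_q)\bigr)$ such that $T=SK$.
   Context: Let $J_{2n}=\begin{bmatrix} 0 & I_n \\ -I_n & 0 \end{bmatrix}$. $\mathrm{Sp}(2n)=\{S\in\mathbb{R}^{2n\times 2n}: S^TJ_{2n}S=J_{2n}\}$, and $\mathrm{OrSp}(2n)$ is the set of matrices in $\mathrm{Sp}(2n)$ that are also orthogonal. Williamson's theorem: for every symmetric positive-definite $M\in\mathbb{R}^{2n\times 2n}$ there is $S\in\mathrm{Sp}(2n)$ with $S^TMS=\mathrm{diag}(D,D)$, where $D$ is an $n\times n$ diagonal matrix with positive diagonal entries arranged in non-decreasing order. The diagonal entries of $D$ (uniquely determined by $M$) are the symplectic eigenvalues of $M$; the multiplicity of a symplectic eigenvalue is the number of times it is repeated in $D$ (so multiplicities sum to $n$). Any $S\in\mathrm{Sp}(2n)$ with $S^TMS=\mathrm{diag}(D,D)$, for this $D$ (entries in non-decreasing order), is said to symplectically diagonalize $M$, and is called a symplectically diagonalizing matrix of $M$. The "dab" notation: for matrices $A^{(i)}=\begin{bmatrix} A^{(i)}_1 & A^{(i)}_2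 \\ {} A^{(i)}_3 & A^{(i)}_4 \end{bmatrix}\in\mathbb{R}^{2k_i\times 2k_i}$, $i=1,\dots,q$, partitioned into four $k_i\times k_i$ blocks, $\mathrm{dab}(A^{(1)},\dots,A^{(q)})=\begin{bmatrix} A_1 & A_2 \\ {} A_3 & A_4 \end{bmatrix}$, where $A_\ell=\mathrm{diag}(A^{(1)}_\ell,\dots,A^{(q)}_\ell)$ (block diagonal) for $\ell=1,\dots,4$. For sets $\Phi^{(i)}$ of such matrices, $\mathrm{dab}(\Phi^{(1)}\times\cdots\times\Phi^{(q)})$ is the set of all $\mathrm{dab}(A^{(1)},\dots,A^{(q)})$ with $A^{(i)}\in\Phi^{(i)}$. *)

theory Defs
  imports "Jordan_Normal_Form.Matrix"
begin

text \<open>Throughout, the argument \<open>n\<close> is half the dimension: \<open>Sp n\<close> is the group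
  usually written \<open>Sp(2n)\<close>.\<close>

definition symplectic_form :: "nat \<Rightarrow> real mat" where
  "symplectic_form n = four_block_mat (0\<^sub>m n n) (1\<^sub>m n) (- 1\<^sub>m n) (0\<^sub>m n n)"

definition Sp :: "nat \<Rightarrow> real mat set" where
  "Sp n = {S \<in> carrier_mat (2 * n) (2 * n).
     transpose_mat S * symplectic_form n * S = symplectic_form n}"

text \<open>The library's \<open>orthogonal_mat\<close> only asks for nonzero, pairwise orthogonal columns,
  so orthogonality is written out here.\<close>

definition OrSp :: "nat \<Rightarrow> real mat set" where
  "OrSp n = {S \<in> Sp n. transpose_mat S * S = 1\<^sub>m (2 * n)}"

definition symmetric_positive_definite :: "nat \<Rightarrow> real mat \<Rightarrow> bool" where
  "symmetric_positive_definite N M \<longleftrightarrow>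
     M \<in> carrier_mat N N \<and> transpose_mat M = M \<and>
     (\<forall>v \<in> carrier_vec N. v \<noteq> 0\<^sub>v N \<longrightarrow> v \<bullet> (M *\<^sub>v v) > 0)"

text \<open>The matrix \<open>diag(D, D)\<close>, where \<open>D\<close> is diagonal with entries \<open>ds\<close>.\<close>

definition double_diag :: "real list \<Rightarrow> real mat" where
  "double_diag ds =
     (let k = length ds; D = mat_diag k (\<lambda>i. ds ! i)
      in four_block_mat D (0\<^sub>m k k) (0\<^sub>m k k) D)"

definition williamson_form :: "nat \<Rightarrow> real mat \<Rightarrow> real mat \<Rightarrow> real list \<Rightarrow> bool" where
  "williamson_form n M S ds \<longleftrightarrow>
     S \<in> Sp n \<and> length ds = n \<and> sorted ds \<and> (\<forall>x \<in> set ds. 0 < x) \<and>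
     transpose_mat S * M * S = double_diag ds"

text \<open>With repetitions, in non-decreasing order. It is well defined for
  symmetric positive-definite \<open>M\<close>: existence is Williamson's theorem, and uniqueness
  holds because \<open>S\<^sup>T M S = diag(D, D)\<close> makes \<open>J M\<close> similar to
  \<open>J diag(D, D)\<close>, whose eigenvalues are \<open>\<plusminus>\<i> D\<^sub>j\<^sub>j\<close>.\<close>

definition symplectic_eigenvalues :: "nat \<Rightarrow> real mat \<Rightarrow> real list" where
  "symplectic_eigenvalues n M = (THE ds. \<exists>S. williamson_form n M S ds)"

definition symplectic_multiplicity :: "nat \<Rightarrow> real mat \<Rightarrow> real \<Rightarrow> nat" where
  "symplectic_multiplicity n M x = count_list (symplectic_eigenvalues n M) x"

definition symplectically_diagonalizes :: "nat \<Rightarrow> real mat \<Rightarrow> real mat \<Rightarrow> bool" where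
  "symplectically_diagonalizes n M S \<longleftrightarrow> williamson_form n M S (symplectic_eigenvalues n M)"

text \<open>The four \<open>k \<times> k\<close> blocks of a \<open>2k \<times> 2k\<close> matrix.\<close>

definition quarter_blocks :: "'a mat \<Rightarrow> 'a mat \<times> 'a mat \<times> 'a mat \<times> 'a mat" where
  "quarter_blocks A = split_block A (dim_row A div 2) (dim_col A div 2)"

definition dab :: "'a :: zero mat list \<Rightarrow> 'a mat" where
  "dab As = four_block_mat
     (diag_block_mat (map (\<lambda>A. case quarter_blocks A of (A1, A2, A3, A4) \<Rightarrow> A1) As))
     (diag_block_mat (map (\<lambda>A. case quarter_blocks A of (A1, A2, A3, A4) \<Rightarrow> A2) As))
     (diag_block_mat (map (\<lambda>A. case quarter_blocks A of (A1, A2, A3, A4) \<Rightarrow> A3) As))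
     (diag_block_mat (map (\<lambda>A. case quarter_blocks A of (A1, A2, A3, A4) \<Rightarrow> A4) As))"

text \<open>The product of the sets is the library's \<open>listset\<close>: all lists whose \<open>i\<close>-th entry
  lies in the \<open>i\<close>-th set.\<close>

definition dab_set :: "'a :: zero mat set list \<Rightarrow> 'a mat set" where
  "dab_set \<Phi>s = dab ` listset \<Phi>s"

end

theory Submission
  imports Defs "Jordan_Normal_Form.Determinant" "HOL-Library.Multiset"
begin

text \<open>Write \<open>\<Lambda> = diag(D, D)\<close> and \<open>T = S K\<close>. If \<open>T\<close> also diagonalizes \<open>M\<close>, then \<open>K\<^sup>T J K = J\<close> and
  \<open>K\<^sup>T \<Lambda> K = \<Lambda>\<close>, so \<open>K\<close> commutes with \<open>J \<Lambda>\<close>, hence with \<open>(J \<Lambda>)\<^sup>2 = - \<Lambda>\<^sup>2\<close>. As the entries of \<open>\<Lambda>\<close>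
  are positive, \<open>K\<close> vanishes wherever they differ, which is the \<open>dab\<close> pattern; and \<open>K\<close> commutes
  with \<open>\<Lambda>\<close>, so \<open>K\<^sup>T \<Lambda> K = \<Lambda>\<close> gives \<open>K\<^sup>T K = 1\<close>. Both identities pass between \<open>K\<close> and its
  blocks because \<open>dab\<close> is an injective homomorphism compatible with transposition that sends
  the forms \<open>J\<close> of the blocks to \<open>J\<close>. Uniqueness of the symplectic eigenvalues is never needed, since
  \<open>S\<close> and \<open>T\<close> refer to the same list.\<close>

section \<open>Block-diagonal matrices over an indexed family of blocks\<close>

lemma four_block_mat_inject:
  assumes "A1 \<in> carrier_mat nr1 nc1" "B1 \<in> carrier_mat nr1 nc2"
    "C1 \<in> carrier_mat nr2 nc1" "D1 \<in> carrier_mat nr2 nc2"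
    and "A2 \<in> carrier_mat nr1 nc1" "B2 \<in> carrier_mat nr1 nc2"
    "C2 \<in> carrier_mat nr2 nc1" "D2 \<in> carrier_mat nr2 nc2"
    and eq: "four_block_mat A1 B1 C1 D1 = four_block_mat A2 B2 C2 D2"
  shows "A1 = A2 \<and> B1 = B2 \<and> C1 = C2 \<and> D1 = D2"
proof -
  have e: "four_block_mat A1 B1 C1 D1 $$ (i, j) = four_block_mat A2 B2 C2 D2 $$ (i, j)" for i j
    using eq by simp
  have "A1 $$ (i, j) = A2 $$ (i, j)" if "i < nr1" "j < nc1" for i j
    using e[of i j] assms(1-8) that by simp
  moreover have "B1 $$ (i, j) = B2 $$ (i, j)" if "i < nr1" "j < nc2" for i j
    using e[of i "j + nc1"] assms(1-8) that by simp
  moreover have "C1 $$ (i, j) = C2 $$ (i, j)" if "i < nr2" "j < nc1" for i j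
    using e[of "i + nr1" j] assms(1-8) that by simp
  moreover have "D1 $$ (i, j) = D2 $$ (i, j)" if "i < nr2" "j < nc2" for i j
    using e[of "i + nr1" "j + nc1"] assms(1-8) that by simp
  ultimately show ?thesis
    using assms by (auto intro!: eq_matI)
qed

text \<open>Lists of blocks are written as \<open>map f xs\<close> throughout, with sizes
  \<open>k x\<close> and \<open>l x\<close>. Blocks of different families that are to be combined
  then share an index, and their sizes match by construction.\<close>

lemma diag_block_mat_carrier:
  assumes "\<forall>x \<in> set xs. f x \<in> carrier_mat (k x) (l x)"
  shows "diag_block_mat (map f xs) \<in> carrier_mat (sum_list (map k xs)) (sum_list (map l xs))"
proof -
  have "map dim_row (map f xs) = map k xs" "map dim_col (map f xs) = map l xs"
    using assms by auto
  then show ?thesis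
    by (intro carrier_matI) (simp_all only: dim_diag_block_mat)
qed

text \<open>The defining recursion reads the sizes of the zero blocks off the matrices. In terms of
  \<open>k\<close> and \<open>l\<close> they are visibly the same for two families, so the
  four-block rules for products, sums and transposes apply in the inductions below.\<close>

lemma diag_block_mat_Cons_map:
  assumes "\<forall>y \<in> set (x # xs). f y \<in> carrier_mat (k y) (l y)"
  shows "diag_block_mat (map f (x # xs)) =
    four_block_mat (f x) (0\<^sub>m (k x) (sum_list (map l xs)))
      (0\<^sub>m (sum_list (map k xs)) (l x)) (diag_block_mat (map f xs))"
proof -
  have "diag_block_mat (map f xs) \<in> carrier_mat (sum_list (map k xs)) (sum_list (map l xs))"
    using assms by (intro diag_block_mat_carrier) simp
  moreover have "f x \<in> carrier_mat (k x) (l x)"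
    using assms by simp
  ultimately show ?thesis
    by (simp add: Let_def)
qed

lemma diag_block_mat_mult:
  fixes f g :: "'b \<Rightarrow> 'a :: semiring_0 mat"
  assumes "\<forall>x \<in> set xs. f x \<in> carrier_mat (k x) (l x)"
    and "\<forall>x \<in> set xs. g x \<in> carrier_mat (l x) (r x)"
  shows "diag_block_mat (map f xs) * diag_block_mat (map g xs) =
    diag_block_mat (map (\<lambda>x. f x * g x) xs)"
  using assms
proof (induction xs)
  case (Cons x xs)
  let ?F = "diag_block_mat (map f xs)" and ?G = "diag_block_mat (map g xs)"
  have F: "?F \<in> carrier_mat (sum_list (map k xs)) (sum_list (map l xs))"
    and G: "?G \<in> carrier_mat (sum_list (map l xs)) (sum_list (map r xs))"
    using Cons.prems by (auto intro!: diag_block_mat_carrier)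
  have fx: "f x \<in> carrier_mat (k x) (l x)" and gx: "g x \<in> carrier_mat (l x) (r x)"
    using Cons.prems by auto
  have fg: "\<forall>y \<in> set (x # xs). f y * g y \<in> carrier_mat (k y) (r y)"
    using Cons.prems by (auto intro: mult_carrier_mat)
  have "?F * ?G = diag_block_mat (map (\<lambda>x. f x * g x) xs)"
    using Cons by auto
  then show ?case
    unfolding diag_block_mat_Cons_map[OF Cons.prems(1)] diag_block_mat_Cons_map[OF Cons.prems(2)]
      diag_block_mat_Cons_map[OF fg]
    using F G fx gx mult_carrier_mat[OF F G] mult_carrier_mat[OF fx gx]
    by (subst mult_four_block_mat[OF fx _ _ F gx _ _ G]) auto
qed simp

lemma diag_block_mat_add:
  fixes f g :: "'b \<Rightarrow> 'a :: monoid_add mat"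
  assumes "\<forall>x \<in> set xs. f x \<in> carrier_mat (k x) (l x)"
    and "\<forall>x \<in> set xs. g x \<in> carrier_mat (k x) (l x)"
  shows "diag_block_mat (map f xs) + diag_block_mat (map g xs) =
    diag_block_mat (map (\<lambda>x. f x + g x) xs)"
  using assms
proof (induction xs)
  case (Cons x xs)
  let ?F = "diag_block_mat (map f xs)" and ?G = "diag_block_mat (map g xs)"
  have F: "?F \<in> carrier_mat (sum_list (map k xs)) (sum_list (map l xs))"
    and G: "?G \<in> carrier_mat (sum_list (map k xs)) (sum_list (map l xs))"
    using Cons.prems by (auto intro!: diag_block_mat_carrier)
  have fx: "f x \<in> carrier_mat (k x) (l x)" and gx: "g x \<in> carrier_mat (k x) (l x)"
    using Cons.prems by auto
  have fg: "\<forall>y \<in> set (x # xs). f y + g y \<in> carrier_mat (k y) (l y)"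
    using Cons.prems by auto
  have "?F + ?G = diag_block_mat (map (\<lambda>x. f x + g x) xs)"
    using Cons by auto
  then show ?case
    unfolding diag_block_mat_Cons_map[OF Cons.prems(1)] diag_block_mat_Cons_map[OF Cons.prems(2)]
      diag_block_mat_Cons_map[OF fg]
    using F G fx gx
    by (subst add_four_block_mat[OF fx _ _ F gx _ _ G]) auto
qed (auto intro!: eq_matI)

lemma diag_block_mat_transpose:
  assumes "\<forall>x \<in> set xs. f x \<in> carrier_mat (k x) (l x)"
  shows "transpose_mat (diag_block_mat (map f xs)) =
    diag_block_mat (map (\<lambda>x. transpose_mat (f x)) xs)"
  using assms
proof (induction xs)
  case (Cons x xs)
  let ?F = "diag_block_mat (map f xs)"
  have F: "?F \<in> carrier_mat (sum_list (map k xs)) (sum_list (map l xs))"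
    using Cons.prems by (auto intro!: diag_block_mat_carrier)
  have fx: "f x \<in> carrier_mat (k x) (l x)"
    using Cons.prems by auto
  have t: "\<forall>y \<in> set (x # xs). transpose_mat (f y) \<in> carrier_mat (l y) (k y)"
    using Cons.prems by auto
  have "transpose_mat ?F = diag_block_mat (map (\<lambda>x. transpose_mat (f x)) xs)"
    using Cons by auto
  then show ?case
    unfolding diag_block_mat_Cons_map[OF Cons.prems] diag_block_mat_Cons_map[OF t]
    by (subst transpose_four_block_mat[OF fx _ _ F]) auto
qed simp

text \<open>Equal sizes mean that both matrices are cut at the same places, so head and tail can be
  compared separately. The assembled matrix alone does not determine the cuts.\<close>

lemma diag_block_mat_inject:
  assumes "\<forall>x \<in> set xs. f x \<in> carrier_mat (k x) (l x)"
    and "\<forall>x \<in> set xs. g x \<in> carrier_mat (k x) (l x)"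
    and "diag_block_mat (map f xs) = diag_block_mat (map g xs)"
    and "x \<in> set xs"
  shows "f x = g x"
  using assms
proof (induction xs)
  case (Cons y xs)
  let ?F = "diag_block_mat (map f xs)" and ?G = "diag_block_mat (map g xs)"
  have F: "?F \<in> carrier_mat (sum_list (map k xs)) (sum_list (map l xs))"
    and G: "?G \<in> carrier_mat (sum_list (map k xs)) (sum_list (map l xs))"
    using Cons.prems by (auto intro!: diag_block_mat_carrier)
  have fy: "f y \<in> carrier_mat (k y) (l y)" and gy: "g y \<in> carrier_mat (k y) (l y)"
    using Cons.prems by auto
  have "f y = g y \<and> ?F = ?G"
    using four_block_mat_inject[OF fy _ _ F gy _ _ G
        Cons.prems(3)[unfolded diag_block_mat_Cons_map[OF Cons.prems(1)]
          diag_block_mat_Cons_map[OF Cons.prems(2)]]] by auto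
  then show ?case
    using Cons.IH Cons.prems by auto
qed simp

lemma diag_block_mat_zero:
  "diag_block_mat (map (\<lambda>x. 0\<^sub>m (k x) (l x)) xs) =
    0\<^sub>m (sum_list (map k xs)) (sum_list (map l xs))"
  by (induction xs) (simp_all add: Let_def)

lemma diag_block_mat_one:
  "diag_block_mat (map (\<lambda>x. 1\<^sub>m (k x)) xs) = 1\<^sub>m (sum_list (map k xs))"
  by (induction xs) (auto simp add: Let_def intro!: eq_matI)

lemma diag_block_mat_minus_one:
  "diag_block_mat (map (\<lambda>x. - 1\<^sub>m (k x)) xs) = (- 1\<^sub>m (sum_list (map k xs)) :: 'a :: ring_1 mat)"
  by (induction xs) (auto simp add: Let_def intro!: eq_matI)

text \<open>Serves to view \<open>diag(D, D)\<close> as assembled from scalar blocks, one for each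
  distinct symplectic eigenvalue.\<close>

lemma diag_block_mat_scalar_blocks:
  "diag_block_mat (map (\<lambda>x. d x \<cdot>\<^sub>m 1\<^sub>m (k x)) xs) =
    mat_diag (sum_list (map k xs))
      (\<lambda>i. concat (map (\<lambda>x. replicate (k x) (d x :: 'a :: semiring_1)) xs) ! i)"
proof (induction xs)
  case (Cons x xs)
  then show ?case
    by (intro eq_matI) (auto simp: Let_def mat_diag_def nth_append)
qed (auto simp: mat_diag_def)

text \<open>The induction splits off the leading block. Distinctness of the values makes
  \<open>d x\<close> differ from every later entry of \<open>ds\<close>, so the two off-diagonal
  parts vanish, and the remaining corner inherits the pattern for the tail.\<close>

lemma diag_block_mat_of_zero_pattern:
  fixes d :: "'b \<Rightarrow> 'c"
  assumes "distinct (map d xs)"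
    and "ds = concat (map (\<lambda>x. replicate (k x) (d x)) xs)"
    and "B \<in> carrier_mat (length ds) (length ds)"
    and "\<And>i j. i < length ds \<Longrightarrow> j < length ds \<Longrightarrow> ds ! i \<noteq> ds ! j \<Longrightarrow> B $$ (i, j) = 0"
  shows "\<exists>f. (\<forall>x \<in> set xs. f x \<in> carrier_mat (k x) (k x)) \<and> B = diag_block_mat (map f xs)"
  using assms
proof (induction xs arbitrary: ds B)
  case (Cons x xs)
  define es where "es = concat (map (\<lambda>x. replicate (k x) (d x)) xs)"
  have ds: "ds = replicate (k x) (d x) @ es"
    using Cons.prems by (simp add: es_def)
  have len: "length ds = k x + length es"
    by (simp add: ds)
  have es: "length es = sum_list (map k xs)"
    by (simp add: es_def length_concat o_def)
  have ne: "es ! i \<noteq> d x" if "i < length es" for i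
  proof -
    have "es ! i \<in> d ` set xs"
      using nth_mem[OF that] by (auto simp: es_def)
    then show ?thesis
      using Cons.prems(1) by auto
  qed
  obtain B1 B2 B3 B4 where sp: "split_block B (k x) (k x) = (B1, B2, B3, B4)"
    by (cases "split_block B (k x) (k x)") auto
  have dims: "dim_row B = k x + length es" "dim_col B = k x + length es"
    using Cons.prems(3) len by auto
  note b = split_block[OF sp dims]
  have z: "B $$ (i, j) = 0" if "i < k x + length es" "j < k x + length es"
    "ds ! i \<noteq> ds ! j" for i j
    using Cons.prems(4) that len by auto
  have B2: "B2 = 0\<^sub>m (k x) (length es)"
  proof (rule eq_matI)
    fix i j assume "i < dim_row (0\<^sub>m (k x) (length es) :: 'a mat)"
      "j < dim_col (0\<^sub>m (k x) (length es) :: 'a mat)"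
    then show "B2 $$ (i, j) = 0\<^sub>m (k x) (length es) $$ (i, j)"
      using z[of i "k x + j"] ne[of j] b by (auto simp: ds nth_append)
  qed (use b in auto)
  have B3: "B3 = 0\<^sub>m (length es) (k x)"
  proof (rule eq_matI)
    fix i j assume "i < dim_row (0\<^sub>m (length es) (k x) :: 'a mat)"
      "j < dim_col (0\<^sub>m (length es) (k x) :: 'a mat)"
    then show "B3 $$ (i, j) = 0\<^sub>m (length es) (k x) $$ (i, j)"
      using z[of "k x + i" j] ne[of i] b by (auto simp: ds nth_append)
  qed (use b in auto)
  have "\<exists>f. (\<forall>x \<in> set xs. f x \<in> carrier_mat (k x) (k x)) \<and> B4 = diag_block_mat (map f xs)"
  proof (rule Cons.IH[OF _ es_def b(4)])
    show "distinct (map d xs)"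
      using Cons.prems by simp
    fix i j assume "i < length es" "j < length es" "es ! i \<noteq> es ! j"
    then show "B4 $$ (i, j) = 0"
      using z[of "k x + i" "k x + j"] b by (auto simp: ds nth_append)
  qed
  then obtain f where f: "\<forall>x \<in> set xs. f x \<in> carrier_mat (k x) (k x)"
    "B4 = diag_block_mat (map f xs)" by blast
  \<comment> \<open>The update leaves the blocks of the tail alone, because distinctness of
    \<open>map d (x # xs)\<close> excludes \<open>x\<close> from \<open>xs\<close>.\<close>
  define g where "g = f(x := B1)"
  have x: "x \<notin> set xs"
    using Cons.prems(1) by auto
  have mg: "map g xs = map f xs"
    using x by (auto simp: g_def)
  have g: "\<forall>y \<in> set (x # xs). g y \<in> carrier_mat (k y) (k y)"
    using f b(1) by (auto simp: g_def)
  have "g x = B1"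
    by (simp add: g_def)
  then have "B = diag_block_mat (map g (x # xs))"
    unfolding diag_block_mat_Cons_map[OF g] mg
    using b(5) B2 B3 f(2) es by simp
  with g show ?case by blast
qed auto

section \<open>The algebra of \<open>dab\<close>: products, transposes, injectivity\<close>

lemma quarter_blocks_four_block_mat:
  assumes "A \<in> carrier_mat k k" "B \<in> carrier_mat k k" "C \<in> carrier_mat k k" "D \<in> carrier_mat k k"
  shows "quarter_blocks (four_block_mat A B C D) = (A, B, C, D)"
proof -
  have d: "dim_row (four_block_mat A B C D) = k + k" "dim_col (four_block_mat A B C D) = k + k"
    using assms by auto
  obtain A' B' C' D' where s: "split_block (four_block_mat A B C D) k k = (A', B', C', D')"
    by (cases "split_block (four_block_mat A B C D) k k") auto
  have "A = A' \<and> B = B' \<and> C = C' \<and> D = D'"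
    by (rule four_block_mat_inject[OF assms split_block[OF s d]])
  moreover have "(k + k) div 2 = k" by simp
  ultimately show ?thesis
    using s d by (simp only: quarter_blocks_def)
qed

text \<open>Once the quarters are given as explicit families, every law for \<open>dab\<close>
  reduces to laws for four block-diagonal matrices.\<close>

lemma dab_four_block_mat:
  assumes "\<forall>x \<in> set xs. a x \<in> carrier_mat (k x) (k x)"
    and "\<forall>x \<in> set xs. b x \<in> carrier_mat (k x) (k x)"
    and "\<forall>x \<in> set xs. c x \<in> carrier_mat (k x) (k x)"
    and "\<forall>x \<in> set xs. e x \<in> carrier_mat (k x) (k x)"
  shows "dab (map (\<lambda>x. four_block_mat (a x) (b x) (c x) (e x)) xs) =
    four_block_mat (diag_block_mat (map a xs)) (diag_block_mat (map b xs))
      (diag_block_mat (map c xs)) (diag_block_mat (map e xs))"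
proof -
  have q: "quarter_blocks (four_block_mat (a x) (b x) (c x) (e x)) = (a x, b x, c x, e x)"
    if "x \<in> set xs" for x
    using assms that by (intro quarter_blocks_four_block_mat) auto
  show ?thesis
    unfolding dab_def map_map o_def
    by (intro cong_four_block_mat arg_cong[where f = diag_block_mat] map_cong refl)
      (simp_all add: q)
qed

text \<open>Supplies the quarters as functions of the index, which is the shape that
  \<open>dab_four_block_mat\<close> expects.\<close>

lemma blocks_of_family:
  assumes "\<forall>x \<in> A. f x \<in> carrier_mat (2 * k x) (2 * k x)"
  obtains a b c e where
    "\<forall>x \<in> A. a x \<in> carrier_mat (k x) (k x)"
    "\<forall>x \<in> A. b x \<in> carrier_mat (k x) (k x)"
    "\<forall>x \<in> A. c x \<in> carrier_mat (k x) (k x)"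
    "\<forall>x \<in> A. e x \<in> carrier_mat (k x) (k x)"
    "\<forall>x \<in> A. f x = four_block_mat (a x) (b x) (c x) (e x)"
proof -
  let ?s = "\<lambda>x. split_block (f x) (k x) (k x)"
  define a b c e where "a = (\<lambda>x. fst (?s x))" and "b = (\<lambda>x. fst (snd (?s x)))"
    and "c = (\<lambda>x. fst (snd (snd (?s x))))" and "e = (\<lambda>x. snd (snd (snd (?s x))))"
  note abce = this
  have s: "?s x = (a x, b x, c x, e x)" for x
    by (simp add: abce)
  have d: "dim_row (f x) = k x + k x" "dim_col (f x) = k x + k x" if "x \<in> A" for x
    using assms that by auto
  show ?thesis
    by (rule that[of a b c e]) (use split_block[OF s d] in blast)+
qed

lemma dab_carrier:
  assumes f: "\<forall>x \<in> set xs. f x \<in> carrier_mat (2 * k x) (2 * k x)"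
  shows "dab (map f xs) \<in> carrier_mat (2 * sum_list (map k xs)) (2 * sum_list (map k xs))"
proof -
  obtain a b c e where abce:
    "\<forall>x \<in> set xs. a x \<in> carrier_mat (k x) (k x)"
    "\<forall>x \<in> set xs. b x \<in> carrier_mat (k x) (k x)"
    "\<forall>x \<in> set xs. c x \<in> carrier_mat (k x) (k x)"
    "\<forall>x \<in> set xs. e x \<in> carrier_mat (k x) (k x)"
    and fe: "\<forall>x \<in> set xs. f x = four_block_mat (a x) (b x) (c x) (e x)"
    using f by (rule blocks_of_family)
  have mf: "map f xs = map (\<lambda>x. four_block_mat (a x) (b x) (c x) (e x)) xs"
    using fe by auto
  show ?thesis
    unfolding mf dab_four_block_mat[OF abce] mult_2
    by (intro four_block_carrier_mat diag_block_mat_carrier abce)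
qed

text \<open>Each quarter of a product of four-block matrices is a sum of two products of quarters,
  and block-diagonal matrices of matching sizes are multiplied and added block by block.\<close>

lemma dab_mult:
  fixes f g :: "'b \<Rightarrow> 'a :: semiring_0 mat"
  assumes f: "\<forall>x \<in> set xs. f x \<in> carrier_mat (2 * k x) (2 * k x)"
    and g: "\<forall>x \<in> set xs. g x \<in> carrier_mat (2 * k x) (2 * k x)"
  shows "dab (map f xs) * dab (map g xs) = dab (map (\<lambda>x. f x * g x) xs)"
proof -
  obtain a b c e where abce:
    "\<forall>x \<in> set xs. a x \<in> carrier_mat (k x) (k x)"
    "\<forall>x \<in> set xs. b x \<in> carrier_mat (k x) (k x)"
    "\<forall>x \<in> set xs. c x \<in> carrier_mat (k x) (k x)"
    "\<forall>x \<in> set xs. e x \<in> carrier_mat (k x) (k x)"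
    and fe: "\<forall>x \<in> set xs. f x = four_block_mat (a x) (b x) (c x) (e x)"
    using f by (rule blocks_of_family)
  obtain a' b' c' e' where abce':
    "\<forall>x \<in> set xs. a' x \<in> carrier_mat (k x) (k x)"
    "\<forall>x \<in> set xs. b' x \<in> carrier_mat (k x) (k x)"
    "\<forall>x \<in> set xs. c' x \<in> carrier_mat (k x) (k x)"
    "\<forall>x \<in> set xs. e' x \<in> carrier_mat (k x) (k x)"
    and ge: "\<forall>x \<in> set xs. g x = four_block_mat (a' x) (b' x) (c' x) (e' x)"
    using g by (rule blocks_of_family)
  have mf: "map f xs = map (\<lambda>x. four_block_mat (a x) (b x) (c x) (e x)) xs"
    and mg: "map g xs = map (\<lambda>x. four_block_mat (a' x) (b' x) (c' x) (e' x)) xs"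
    using fe ge by auto
  have mfg: "map (\<lambda>x. f x * g x) xs = map (\<lambda>x. four_block_mat
      (a x * a' x + b x * c' x) (a x * b' x + b x * e' x)
      (c x * a' x + e x * c' x) (c x * b' x + e x * e' x)) xs"
  proof (rule map_cong[OF refl])
    fix x assume x: "x \<in> set xs"
    show "f x * g x = four_block_mat
      (a x * a' x + b x * c' x) (a x * b' x + b x * e' x)
      (c x * a' x + e x * c' x) (c x * b' x + e x * e' x)"
      unfolding fe[rule_format, OF x] ge[rule_format, OF x]
      by (rule mult_four_block_mat[OF abce[rule_format, OF x] abce'[rule_format, OF x]])
  qed
  have p: "\<And>u v. \<forall>x \<in> set xs. u x \<in> carrier_mat (k x) (k x) \<Longrightarrow>
      \<forall>x \<in> set xs. v x \<in> carrier_mat (k x) (k x) \<Longrightarrow>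
      \<forall>x \<in> set xs. (u x * v x :: 'a mat) \<in> carrier_mat (k x) (k x)"
    by (blast intro: mult_carrier_mat)
  note c = diag_block_mat_carrier[OF abce(1)] diag_block_mat_carrier[OF abce(2)]
    diag_block_mat_carrier[OF abce(3)] diag_block_mat_carrier[OF abce(4)]
    diag_block_mat_carrier[OF abce'(1)] diag_block_mat_carrier[OF abce'(2)]
    diag_block_mat_carrier[OF abce'(3)] diag_block_mat_carrier[OF abce'(4)]
  have s: "diag_block_mat (map u xs) * diag_block_mat (map v xs) +
      diag_block_mat (map u' xs) * diag_block_mat (map v' xs) =
      diag_block_mat (map (\<lambda>x. u x * v x + u' x * v' x :: 'a mat) xs)"
    if "\<forall>x \<in> set xs. u x \<in> carrier_mat (k x) (k x)"
      "\<forall>x \<in> set xs. v x \<in> carrier_mat (k x) (k x)"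
      "\<forall>x \<in> set xs. u' x \<in> carrier_mat (k x) (k x)"
      "\<forall>x \<in> set xs. v' x \<in> carrier_mat (k x) (k x)" for u v u' v'
    unfolding diag_block_mat_mult[OF that(1,2)] diag_block_mat_mult[OF that(3,4)]
    by (rule diag_block_mat_add[OF p[OF that(1,2)] p[OF that(3,4)]])
  show ?thesis
    unfolding mf mg mfg dab_four_block_mat[OF abce] dab_four_block_mat[OF abce'] mult_four_block_mat[OF c]
      s[OF abce(1) abce'(1) abce(2) abce'(3)] s[OF abce(1) abce'(2) abce(2) abce'(4)]
      s[OF abce(3) abce'(1) abce(4) abce'(3)] s[OF abce(3) abce'(2) abce(4) abce'(4)]
    by (rule dab_four_block_mat[symmetric, where k = k])
      (use p[OF abce(1) abce'(1)] p[OF abce(1) abce'(2)] p[OF abce(2) abce'(3)] p[OF abce(2) abce'(4)]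
        p[OF abce(3) abce'(1)] p[OF abce(3) abce'(2)] p[OF abce(4) abce'(3)] p[OF abce(4) abce'(4)]
       in simp_all)
qed

text \<open>Transposition exchanges the two off-diagonal quarters, in each block as well as in the
  assembled matrix.\<close>

lemma dab_transpose:
  assumes f: "\<forall>x \<in> set xs. f x \<in> carrier_mat (2 * k x) (2 * k x)"
  shows "transpose_mat (dab (map f xs)) = dab (map (\<lambda>x. transpose_mat (f x)) xs)"
proof -
  obtain a b c e where abce:
    "\<forall>x \<in> set xs. a x \<in> carrier_mat (k x) (k x)"
    "\<forall>x \<in> set xs. b x \<in> carrier_mat (k x) (k x)"
    "\<forall>x \<in> set xs. c x \<in> carrier_mat (k x) (k x)"
    "\<forall>x \<in> set xs. e x \<in> carrier_mat (k x) (k x)"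
    and fe: "\<forall>x \<in> set xs. f x = four_block_mat (a x) (b x) (c x) (e x)"
    using f by (rule blocks_of_family)
  have mf: "map f xs = map (\<lambda>x. four_block_mat (a x) (b x) (c x) (e x)) xs"
    using fe by auto
  have mt: "map (\<lambda>x. transpose_mat (f x)) xs = map (\<lambda>x. four_block_mat
      (transpose_mat (a x)) (transpose_mat (c x)) (transpose_mat (b x)) (transpose_mat (e x))) xs"
    using fe by (auto intro!: transpose_four_block_mat[OF abce[rule_format]])
  note c = diag_block_mat_carrier[OF abce(1)] diag_block_mat_carrier[OF abce(2)]
    diag_block_mat_carrier[OF abce(3)] diag_block_mat_carrier[OF abce(4)]
  show ?thesis
    unfolding mf mt dab_four_block_mat[OF abce] transpose_four_block_mat[OF c]
      diag_block_mat_transpose[OF abce(1)] diag_block_mat_transpose[OF abce(2)]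
      diag_block_mat_transpose[OF abce(3)] diag_block_mat_transpose[OF abce(4)]
    by (rule dab_four_block_mat[symmetric]) (use abce in auto)
qed

text \<open>Allows an identity between assembled matrices to be read off block by block: the
  quarters agree first, then the diagonal blocks of each quarter.\<close>

lemma dab_inject:
  assumes f: "\<forall>x \<in> set xs. f x \<in> carrier_mat (2 * k x) (2 * k x)"
    and g: "\<forall>x \<in> set xs. g x \<in> carrier_mat (2 * k x) (2 * k x)"
    and eq: "dab (map f xs) = dab (map g xs)" and x: "x \<in> set xs"
  shows "f x = g x"
proof -
  obtain a b c e where abce:
    "\<forall>x \<in> set xs. a x \<in> carrier_mat (k x) (k x)"
    "\<forall>x \<in> set xs. b x \<in> carrier_mat (k x) (k x)"
    "\<forall>x \<in> set xs. c x \<in> carrier_mat (k x) (k x)"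
    "\<forall>x \<in> set xs. e x \<in> carrier_mat (k x) (k x)"
    and fe: "\<forall>x \<in> set xs. f x = four_block_mat (a x) (b x) (c x) (e x)"
    using f by (rule blocks_of_family)
  obtain a' b' c' e' where abce':
    "\<forall>x \<in> set xs. a' x \<in> carrier_mat (k x) (k x)"
    "\<forall>x \<in> set xs. b' x \<in> carrier_mat (k x) (k x)"
    "\<forall>x \<in> set xs. c' x \<in> carrier_mat (k x) (k x)"
    "\<forall>x \<in> set xs. e' x \<in> carrier_mat (k x) (k x)"
    and ge: "\<forall>x \<in> set xs. g x = four_block_mat (a' x) (b' x) (c' x) (e' x)"
    using g by (rule blocks_of_family)
  have mf: "map f xs = map (\<lambda>x. four_block_mat (a x) (b x) (c x) (e x)) xs"
    and mg: "map g xs = map (\<lambda>x. four_block_mat (a' x) (b' x) (c' x) (e' x)) xs"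
    using fe ge by auto
  note c = diag_block_mat_carrier[OF abce(1)] diag_block_mat_carrier[OF abce(2)]
    diag_block_mat_carrier[OF abce(3)] diag_block_mat_carrier[OF abce(4)]
    diag_block_mat_carrier[OF abce'(1)] diag_block_mat_carrier[OF abce'(2)]
    diag_block_mat_carrier[OF abce'(3)] diag_block_mat_carrier[OF abce'(4)]
  note i = four_block_mat_inject[OF c
      eq[unfolded mf mg dab_four_block_mat[OF abce] dab_four_block_mat[OF abce']]]
  have "diag_block_mat (map a xs) = diag_block_mat (map a' xs)"
    "diag_block_mat (map b xs) = diag_block_mat (map b' xs)"
    "diag_block_mat (map c xs) = diag_block_mat (map c' xs)"
    "diag_block_mat (map e xs) = diag_block_mat (map e' xs)"
    using i by blast+
  note eqs = diag_block_mat_inject[OF abce(1) abce'(1) this(1) x]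
    diag_block_mat_inject[OF abce(2) abce'(2) this(2) x]
    diag_block_mat_inject[OF abce(3) abce'(3) this(3) x]
    diag_block_mat_inject[OF abce(4) abce'(4) this(4) x]
  show ?thesis
    unfolding fe[rule_format, OF x] ge[rule_format, OF x] eqs ..
qed

section \<open>The symplectic form, \<open>diag(D, D)\<close> and zero patterns in terms of
  \<open>dab\<close>\<close>

lemma symplectic_form_carrier: "symplectic_form n \<in> carrier_mat (2 * n) (2 * n)"
  by (simp add: symplectic_form_def mult_2)

text \<open>This is the point of assembling quarter by quarter: an ordinary block-diagonal sum of
  the forms would in general give \<open>J\<close> only up to a permutation of the
  coordinates.\<close>

lemma dab_symplectic_form:
  "dab (map (\<lambda>x. symplectic_form (k x)) xs) = symplectic_form (sum_list (map k xs))"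
  unfolding symplectic_form_def
  by (subst dab_four_block_mat[where k = k])
    (simp_all add: diag_block_mat_zero diag_block_mat_one diag_block_mat_minus_one)

lemma dab_one:
  "dab (map (\<lambda>x. 1\<^sub>m (2 * k x)) xs) = (1\<^sub>m (2 * sum_list (map k xs)) :: 'a :: {zero,one} mat)"
  unfolding mult_2 four_block_one_mat[symmetric]
  by (subst dab_four_block_mat[where k = k]) (simp_all add: diag_block_mat_zero diag_block_mat_one)

lemma double_diag_carrier: "double_diag ds \<in> carrier_mat (2 * length ds) (2 * length ds)"
  by (simp add: double_diag_def Let_def mult_2)

text \<open>Within the block of a single value \<open>diag(D, D)\<close> is scalar, so congruence by
  an orthogonal block preserves it.\<close>

lemma dab_scalar_blocks:
  "dab (map (\<lambda>x. d x \<cdot>\<^sub>m 1\<^sub>m (2 * k x)) xs) =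
    double_diag (concat (map (\<lambda>x. replicate (k x) (d x)) xs))"
proof -
  have "d x \<cdot>\<^sub>m 1\<^sub>m (2 * k x) = four_block_mat (d x \<cdot>\<^sub>m 1\<^sub>m (k x)) (0\<^sub>m (k x) (k x))
      (0\<^sub>m (k x) (k x)) (d x \<cdot>\<^sub>m 1\<^sub>m (k x))" for x
    by (intro eq_matI) auto
  then show ?thesis
    by (simp add: dab_four_block_mat[where k = k] diag_block_mat_scalar_blocks
        diag_block_mat_zero double_diag_def Let_def length_concat o_def)
qed

text \<open>With a single diagonal \<open>ds @ ds\<close>, entries can be compared without
  distinguishing the four quarters.\<close>

lemma double_diag_eq_mat_diag: "double_diag ds = mat_diag (2 * length ds) (\<lambda>i. (ds @ ds) ! i)"
  by (intro eq_matI) (auto simp: double_diag_def Let_def mat_diag_def nth_append)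

text \<open>Shifting an index by \<open>length ds\<close> does not change the entry of
  \<open>ds @ ds\<close>. The pattern for \<open>K\<close> is therefore the pattern given by
  \<open>ds\<close> on each quarter, and all four quarters are block diagonal with the same block
  sizes.\<close>

lemma dab_of_zero_pattern:
  fixes d :: "'b \<Rightarrow> 'c"
  assumes dist: "distinct (map d xs)"
    and ds: "ds = concat (map (\<lambda>x. replicate (k x) (d x)) xs)"
    and K: "K \<in> carrier_mat (2 * length ds) (2 * length ds)"
    and z: "\<And>i j. i < 2 * length ds \<Longrightarrow> j < 2 * length ds \<Longrightarrow>
      (ds @ ds) ! i \<noteq> (ds @ ds) ! j \<Longrightarrow> K $$ (i, j) = 0"
  obtains f where "\<forall>x \<in> set xs. f x \<in> carrier_mat (2 * k x) (2 * k x)"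
    and "K = dab (map f xs)"
proof -
  let ?n = "length ds"
  obtain A B C D where sp: "split_block K ?n ?n = (A, B, C, D)"
    by (cases "split_block K ?n ?n") auto
  have dims: "dim_row K = ?n + ?n" "dim_col K = ?n + ?n"
    using K by auto
  note b = split_block[OF sp dims]
  note bs = diag_block_mat_of_zero_pattern[OF dist ds]
  have zA: "A $$ (i, j) = 0" and zB: "B $$ (i, j) = 0"
    and zC: "C $$ (i, j) = 0" and zD: "D $$ (i, j) = 0"
    if "i < ?n" "j < ?n" "ds ! i \<noteq> ds ! j" for i j
    using that b(1-4) z[of i j, unfolded b(5)] z[of i "j + ?n", unfolded b(5)]
      z[of "i + ?n" j, unfolded b(5)] z[of "i + ?n" "j + ?n", unfolded b(5)]
    by (auto simp: nth_append)
  obtain fa where fa: "\<forall>x \<in> set xs. fa x \<in> carrier_mat (k x) (k x)" "A = diag_block_mat (map fa xs)"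
    using bs[OF b(1)] zA by blast
  obtain fb where fb: "\<forall>x \<in> set xs. fb x \<in> carrier_mat (k x) (k x)" "B = diag_block_mat (map fb xs)"
    using bs[OF b(2)] zB by blast
  obtain fc where fc: "\<forall>x \<in> set xs. fc x \<in> carrier_mat (k x) (k x)" "C = diag_block_mat (map fc xs)"
    using bs[OF b(3)] zC by blast
  obtain fd where fd: "\<forall>x \<in> set xs. fd x \<in> carrier_mat (k x) (k x)" "D = diag_block_mat (map fd xs)"
    using bs[OF b(4)] zD by blast
  note f = fa fb fc fd
  show ?thesis
  proof (rule that[of "\<lambda>x. four_block_mat (fa x) (fb x) (fc x) (fd x)"])
    show "K = dab (map (\<lambda>x. four_block_mat (fa x) (fb x) (fc x) (fd x)) xs)"
      using f b(5) by (simp add: dab_four_block_mat[where k = k])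
  qed (use f in \<open>auto simp: mult_2\<close>)
qed

section \<open>Symplectic matrices and congruences fixing \<open>diag(D, D)\<close>\<close>

lemma symplectic_form_square: "symplectic_form n * symplectic_form n = - 1\<^sub>m (2 * n)"
proof -
  have "symplectic_form n * symplectic_form n =
    four_block_mat (- 1\<^sub>m n) (0\<^sub>m n n) (0\<^sub>m n n) (- 1\<^sub>m n)"
    unfolding symplectic_form_def by (subst mult_four_block_mat[of _ n n _ n _ n _ _ n _ n]) auto
  also have "\<dots> = - 1\<^sub>m (2 * n)"
    by (intro eq_matI) auto
  finally show ?thesis .
qed

text \<open>\<open>J\<close> exchanges the two halves of the coordinates up to sign, and
  \<open>diag(D, D)\<close> acts in the same way on both halves.\<close>

lemma symplectic_form_double_diag_commute:
  assumes "length ds = n"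
  shows "symplectic_form n * double_diag ds = double_diag ds * symplectic_form n"
proof -
  have neg_zero: "- 0\<^sub>m n n = (0\<^sub>m n n :: real mat)"
    by (intro eq_matI) auto
  define D where "D = mat_diag n (\<lambda>i. ds ! i)"
  have D: "D \<in> carrier_mat n n"
    by (simp add: D_def)
  have "symplectic_form n * double_diag ds = four_block_mat (0\<^sub>m n n) D (- D) (0\<^sub>m n n)"
    unfolding symplectic_form_def double_diag_def Let_def assms D_def[symmetric]
    using D by (subst mult_four_block_mat[of _ n n _ n _ n _ _ n _ n]) auto
  moreover have "double_diag ds * symplectic_form n = four_block_mat (0\<^sub>m n n) D (- D) (0\<^sub>m n n)"
    unfolding symplectic_form_def double_diag_def Let_def assms D_def[symmetric]
    using D by (subst mult_four_block_mat[of _ n n _ n _ n _ _ n _ n]) (auto simp: neg_zero)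
  ultimately show ?thesis by simp
qed

text \<open>Multiplying \<open>S\<^sup>T J S = J\<close> by \<open>- J\<close> from the left shows
  that \<open>- J S\<^sup>T J\<close> is a left inverse; for square matrices it is also a right
  inverse. The last property again follows from \<open>J J = - 1\<close> and trades
  \<open>S\<^sup>T\<close> for the inverse.\<close>

lemma Sp_inverse:
  assumes "S \<in> Sp n"
  obtains L where "L \<in> carrier_mat (2 * n) (2 * n)" "L * S = 1\<^sub>m (2 * n)" "S * L = 1\<^sub>m (2 * n)"
    "L * symplectic_form n = symplectic_form n * transpose_mat S"
proof -
  let ?J = "symplectic_form n" and ?N = "2 * n"
  have S: "S \<in> carrier_mat ?N ?N" and e: "transpose_mat S * ?J * S = ?J"
    using assms by (auto simp: Sp_def)
  have J: "?J \<in> carrier_mat ?N ?N" by (rule symplectic_form_carrier)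
  have St: "transpose_mat S \<in> carrier_mat ?N ?N" using S by simp
  define L where "L = - (?J * (transpose_mat S * ?J))"
  have L: "L \<in> carrier_mat ?N ?N"
    using J St by (auto simp: L_def)
  have "L * S = - (?J * (transpose_mat S * ?J) * S)"
    unfolding L_def using J St S by simp
  also have "?J * (transpose_mat S * ?J) * S = ?J * (transpose_mat S * ?J * S)"
    using J St S by (intro assoc_mult_mat[of _ ?N ?N _ ?N _ ?N]) auto
  also have "- \<dots> = 1\<^sub>m ?N"
    unfolding e symplectic_form_square by simp
  finally have LS: "L * S = 1\<^sub>m ?N" .
  have "L * ?J = - (?J * (transpose_mat S * ?J) * ?J)"
    unfolding L_def using J St by simp
  also have "?J * (transpose_mat S * ?J) * ?J = ?J * (transpose_mat S * (?J * ?J))"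
    using J St by (simp add: assoc_mult_mat[of _ ?N ?N _ ?N _ ?N])
  also have "- \<dots> = ?J * transpose_mat S"
    unfolding symplectic_form_square using J St by simp
  finally have "L * ?J = ?J * transpose_mat S" .
  then show ?thesis
    using that L LS mat_mult_left_right_inverse[OF L S LS] by blast
qed

text \<open>Describes the stabilizer of \<open>diag(D, D)\<close> in the symplectic group under
  congruence; it is applied to the matrix that leads from \<open>S\<close> to
  \<open>T\<close>.\<close>

lemma Sp_congruence_double_diag:
  assumes KSp: "K \<in> Sp n" and len: "length ds = n" and pos: "\<forall>x \<in> set ds. 0 < x"
    and cong: "transpose_mat K * double_diag ds * K = double_diag ds"
  shows "transpose_mat K * K = 1\<^sub>m (2 * n)"
    and "\<And>i j. i < 2 * n \<Longrightarrow> j < 2 * n \<Longrightarrow> (ds @ ds) ! i \<noteq> (ds @ ds) ! j \<Longrightarrow> K $$ (i, j) = 0"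
proof -
  let ?J = "symplectic_form n" and ?N = "2 * n"
  define D where "D = double_diag ds"
  define l where "l = (\<lambda>i. (ds @ ds) ! i)"
  have Dl: "D = mat_diag ?N l"
    by (simp add: D_def l_def double_diag_eq_mat_diag len)
  \<comment> \<open>Positivity enters twice: \<open>l j + l i\<close> is nonzero, so distinct
    entries have distinct squares, and \<open>l j\<close> can be cancelled when
    \<open>K\<^sup>T K\<close> is computed.\<close>
  have lpos: "l i > 0" if "i < ?N" for i
  proof -
    have "l i \<in> set (ds @ ds)"
      unfolding l_def using that len by (intro nth_mem) simp
    then show ?thesis using pos by simp
  qed
  have K: "K \<in> carrier_mat ?N ?N" using KSp by (auto simp: Sp_def)
  have J: "?J \<in> carrier_mat ?N ?N" by (rule symplectic_form_carrier)
  have D: "D \<in> carrier_mat ?N ?N" by (simp add: Dl)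
  have Kt: "transpose_mat K \<in> carrier_mat ?N ?N" using K by simp
  obtain L where L: "L \<in> carrier_mat ?N ?N" and KL: "K * L = 1\<^sub>m ?N"
    and LJ: "L * ?J = ?J * transpose_mat K"
    using Sp_inverse[OF KSp] by blast
  note assoc = assoc_mult_mat[of _ ?N ?N _ ?N _ ?N]
  define A where "A = ?J * D"
  have A: "A \<in> carrier_mat ?N ?N" using J D by (auto simp: A_def)
  \<comment> \<open>\<open>K\<close> commutes with \<open>J D\<close>: after replacing
    \<open>D\<close> by \<open>K\<^sup>T D K\<close>, the factor \<open>K J K\<^sup>T\<close>
    becomes \<open>K L J = J\<close>.\<close>
  have "K * A = K * (?J * (transpose_mat K * D * K))"
    using cong by (simp add: A_def D_def)
  also have "\<dots> = K * (?J * transpose_mat K) * (D * K)"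
    using K J Kt D by (simp add: assoc)
  also have "\<dots> = K * L * (?J * (D * K))"
    unfolding LJ[symmetric] using K J L D by (simp add: assoc)
  also have "\<dots> = A * K"
    unfolding KL using K J D by (simp add: assoc A_def)
  finally have KA: "K * A = A * K" .
  \<comment> \<open>Squaring removes \<open>J\<close> and leaves a diagonal matrix, so that
    commutation with it can be tested entry by entry.\<close>
  have "A * A = ?J * (D * ?J) * D"
    unfolding A_def using J D by (simp add: assoc)
  also have "\<dots> = (?J * ?J) * (D * D)"
    unfolding D_def symplectic_form_double_diag_commute[OF len, symmetric]
    using J D[unfolded D_def] by (simp add: assoc)
  also have "\<dots> = - (D * D)"
    unfolding symplectic_form_square using D by simp
  finally have AA: "A * A = - (D * D)" .
  have "K * (A * A) = K * A * A"
    using K A by (simp add: assoc)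
  also have "\<dots> = A * K * A"
    by (simp only: KA)
  also have "\<dots> = A * (K * A)"
    using K A by (simp add: assoc)
  also have "\<dots> = A * (A * K)"
    by (simp only: KA)
  also have "\<dots> = A * A * K"
    using K A by (simp add: assoc)
  finally have "K * (D * D) = D * D * K"
    unfolding AA using K D by (metis uminus_mult_left_mat uminus_mult_right_mat
        uminus_uminus_mat carrier_matD mult_carrier_mat)
  then have sq: "K * mat_diag ?N (\<lambda>i. l i * l i) = mat_diag ?N (\<lambda>i. l i * l i) * K"
    by (simp add: Dl)
  have sq': "K $$ (i, j) * (l j * l j) = l i * l i * K $$ (i, j)" if "i < ?N" "j < ?N" for i j
    using arg_cong[OF sq, of "\<lambda>X. X $$ (i, j)"] that K
    by (simp add: mat_diag_mult_left[OF K] mat_diag_mult_right[OF K])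
  have zero: "K $$ (i, j) = 0" if ij: "i < ?N" "j < ?N" and ne: "l i \<noteq> l j" for i j
  proof -
    have "K $$ (i, j) * ((l j - l i) * (l j + l i)) = 0"
      using sq'[OF ij] by (simp add: algebra_simps)
    then show ?thesis
      using ne lpos[OF ij(1)] lpos[OF ij(2)] by auto
  qed
  then show "\<And>i j. i < 2 * n \<Longrightarrow> j < 2 * n \<Longrightarrow> (ds @ ds) ! i \<noteq> (ds @ ds) ! j \<Longrightarrow> K $$ (i, j) = 0"
    by (simp add: l_def)
  \<comment> \<open>The zeros of \<open>K\<close> improve commutation with \<open>D * D\<close> to
    commutation with \<open>D\<close>: at each position either the two diagonal entries agree or
    \<open>K\<close> vanishes.\<close>
  have "D * K = K * D"
    unfolding Dl mat_diag_mult_left[OF K] mat_diag_mult_right[OF K]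
  proof (rule eq_matI)
    fix i j assume "i < dim_row (mat ?N ?N (\<lambda>(i, j). K $$ (i, j) * l j))"
      "j < dim_col (mat ?N ?N (\<lambda>(i, j). K $$ (i, j) * l j))"
    then show "mat ?N ?N (\<lambda>(i, j). l i * K $$ (i, j)) $$ (i, j) =
        mat ?N ?N (\<lambda>(i, j). K $$ (i, j) * l j) $$ (i, j)"
      using zero[of i j] by (cases "l i = l j") simp_all
  qed simp_all
  then have "transpose_mat K * K * D = transpose_mat K * (D * K)"
    using K Kt D by (simp add: assoc)
  also have "\<dots> = D"
    using cong K Kt D by (simp add: assoc D_def)
  finally have PD: "transpose_mat K * K * mat_diag ?N l = mat_diag ?N l"
    by (simp add: Dl)
  define P where "P = transpose_mat K * K"
  have P: "P \<in> carrier_mat ?N ?N" using K by (auto simp: P_def)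
  have "P = 1\<^sub>m ?N"
  proof (rule eq_matI)
    fix i j assume "i < dim_row (1\<^sub>m ?N :: real mat)" "j < dim_col (1\<^sub>m ?N :: real mat)"
    then have ij: "i < ?N" "j < ?N" by auto
    \<comment> \<open>Moving \<open>D\<close> past \<open>K\<close> turned the congruence into
      \<open>P D = D\<close>; column \<open>j\<close> of this equation is divided by
      \<open>l j\<close>.\<close>
    have "P $$ (i, j) * l j = (if i = j then l j else 0)"
      using arg_cong[OF PD[folded P_def], of "\<lambda>X. X $$ (i, j)"] ij
      by (simp add: mat_diag_mult_right[OF P]) (simp add: mat_diag_def)
    then show "P $$ (i, j) = 1\<^sub>m ?N $$ (i, j)"
      using lpos[OF ij(2)] ij by (auto split: if_splits)
  qed (use P in auto)
  then show "transpose_mat K * K = 1\<^sub>m (2 * n)"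
    by (simp add: P_def)
qed

section \<open>Grouping a sorted list by value, and products of sets\<close>

text \<open>Both lists are sorted and have the same multiset of entries, hence they
  coincide.\<close>

lemma concat_replicate_count_list:
  fixes ds :: "'a :: linorder list"
  assumes "sorted ds" "sorted_wrt (<) xs" "set xs = set ds"
  shows "concat (map (\<lambda>x. replicate (count_list ds x) x) xs) = ds"
proof -
  have s: "sorted (concat (map (\<lambda>x. replicate (c x) x) xs))" if "sorted_wrt (<) xs"
    for c :: "'a \<Rightarrow> nat" and xs
    using that by (induction xs) (auto simp: sorted_append less_imp_le)
  have n: "count_list (replicate k x) y = (if x = y then k else 0)" for k and x y :: 'a
    by (induction k) auto
  have c: "count_list (concat (map (\<lambda>x. replicate (c x) x) xs)) y =
      (if y \<in> set xs then c y else 0)" if "distinct xs"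
    for c :: "'a \<Rightarrow> nat" and xs y
    using that by (induction xs) (auto simp: n)
  have "distinct xs"
    using assms(2) by (simp only: strict_sorted_iff)
  then have "mset (concat (map (\<lambda>x. replicate (count_list ds x) x) xs)) = mset ds"
    using assms(3) by (intro multiset_eqI) (simp add: c count_mset)
  then have "sort ds = concat (map (\<lambda>x. replicate (count_list ds x) x) xs)"
    using s[OF assms(2)] by (rule properties_for_sort)
  then show ?thesis
    using assms(1) by (simp only: sorted_sort_id)
qed

text \<open>Distinct indices make the choices at different positions independent, so an element of
  the product is a function on the index set. This connects \<open>dab_set\<close> with the families
  \<open>map f xs\<close>.\<close>

lemma listset_map:
  assumes "distinct xs"
  shows "ys \<in> listset (map F xs) \<longleftrightarrow> (\<exists>f. ys = map f xs \<and> (\<forall>x \<in> set xs. f x \<in> F x))"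
  using assms
proof (induction xs arbitrary: ys)
  case (Cons x xs)
  show ?case
  proof
    assume "ys \<in> listset (map F (x # xs))"
    then obtain y zs where y: "ys = y # zs" "y \<in> F x" and "zs \<in> listset (map F xs)"
      by (auto simp: set_Cons_def)
    then obtain f where "zs = map f xs" "\<forall>x \<in> set xs. f x \<in> F x"
      using Cons by auto
    then show "\<exists>f. ys = map f (x # xs) \<and> (\<forall>x \<in> set (x # xs). f x \<in> F x)"
      using y Cons.prems by (intro exI[of _ "f(x := y)"]) auto
  next
    assume "\<exists>f. ys = map f (x # xs) \<and> (\<forall>x \<in> set (x # xs). f x \<in> F x)"
    then obtain f where "ys = f x # map f xs" "f x \<in> F x" "\<forall>x \<in> set xs. f x \<in> F x"
      by auto
    then show "ys \<in> listset (map F (x # xs))"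
      using Cons by (auto simp: set_Cons_def)
  qed
qed auto

section \<open>All diagonalizing matrices obtained from a given one\<close>

theorem theorem3p6:
  fixes n q :: nat and M S T :: "real mat"
    and d :: "nat \<Rightarrow> real" and m :: "nat \<Rightarrow> nat"
  assumes "symmetric_positive_definite (2 * n) M"
    and "q \<le> n"
    and "strict_mono_on {1..q} d"
    and "d ` {1..q} = set (symplectic_eigenvalues n M)"
    and "\<And>i. i \<in> {1..q} \<Longrightarrow> m i = symplectic_multiplicity n M (d i)"
    and "S \<in> Sp n"
    and "symplectically_diagonalizes n M S"
    and "T \<in> Sp n"
  shows "symplectically_diagonalizes n M T \<longleftrightarrow>
    (\<exists>K \<in> dab_set (map (\<lambda>i. OrSp (m i)) [1..<Suc q]). T = S * K)"
proof -
  define ds where "ds = symplectic_eigenvalues n M"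
  define xs where "xs = [1..<Suc q]"
  define D where "D = double_diag ds"
  let ?J = "symplectic_form n" and ?N = "2 * n"
  \<comment> \<open>Length, order and positivity of the list are taken from \<open>S\<close>, which
    brings \<open>M\<close> to the form with exactly this list.\<close>
  have W: "williamson_form n M S ds"
    using assms(7) by (simp add: symplectically_diagonalizes_def ds_def)
  then have len: "length ds = n" and "sorted ds" and pos: "\<forall>x \<in> set ds. 0 < x"
    and SMS: "transpose_mat S * M * S = D"
    by (auto simp: williamson_form_def D_def)
  have setxs: "set xs = {1..q}" and dxs: "distinct xs" "sorted_wrt (<) xs"
    by (auto simp: xs_def simp del: upt_Suc)
  have sd: "sorted_wrt (<) (map d xs)"
    unfolding sorted_wrt_map
    by (rule sorted_wrt_mono_rel[OF _ dxs(2)])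
      (use assms(3) setxs in \<open>auto simp: strict_mono_on_def\<close>)
  have "map (\<lambda>x. replicate (m x) (d x)) xs =
      map (\<lambda>x. replicate (count_list ds x) x) (map d xs)"
    using assms(5) setxs by (simp add: symplectic_multiplicity_def ds_def)
  moreover have "set (map d xs) = set ds"
    using assms(4) setxs by (simp add: ds_def)
  \<comment> \<open>The multiplicities become block sizes here: \<open>ds\<close> consists of
    \<open>m x\<close> copies of \<open>d x\<close>, in the order of the indices.\<close>
  ultimately have ds: "ds = concat (map (\<lambda>x. replicate (m x) (d x)) xs)"
    by (simp only: concat_replicate_count_list[OF \<open>sorted ds\<close> sd])
  have sum: "sum_list (map m xs) = n"
    using len by (simp add: ds length_concat o_def)
  have M: "M \<in> carrier_mat ?N ?N"
    using assms(1) by (simp add: symmetric_positive_definite_def)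
  have S: "S \<in> carrier_mat ?N ?N" and SJ: "transpose_mat S * ?J * S = ?J"
    using assms(6) by (auto simp: Sp_def)
  have T: "T \<in> carrier_mat ?N ?N" and TJ: "transpose_mat T * ?J * T = ?J"
    using assms(8) by (auto simp: Sp_def)
  have St: "transpose_mat S \<in> carrier_mat ?N ?N" using S by simp
  have J: "?J \<in> carrier_mat ?N ?N" by (rule symplectic_form_carrier)
  have D: "D \<in> carrier_mat ?N ?N"
    using double_diag_carrier[of ds] by (simp add: D_def len)
  have Ddab: "D = dab (map (\<lambda>x. d x \<cdot>\<^sub>m 1\<^sub>m (2 * m x)) xs)"
    unfolding D_def by (subst ds) (rule dab_scalar_blocks[symmetric])
  have Jdab: "?J = dab (map (\<lambda>x. symplectic_form (m x)) xs)"
    by (simp add: dab_symplectic_form sum)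
  \<comment> \<open>Congruence by \<open>S * K\<close> is congruence by \<open>S\<close> followed by
    \<open>K\<close>. With \<open>X\<close> equal to \<open>J\<close> or \<open>M\<close> this moves
    statements about \<open>T\<close> to \<open>K\<close>.\<close>
  have congr: "transpose_mat (S * K) * X * (S * K) =
      transpose_mat K * (transpose_mat S * X * S) * K"
    if "K \<in> carrier_mat ?N ?N" "X \<in> carrier_mat ?N ?N" for K X
  proof -
    have "transpose_mat K \<in> carrier_mat ?N ?N"
      using that by simp
    then show ?thesis
      unfolding transpose_mult[OF S that(1)]
      using that S St by (simp add: assoc_mult_mat[of _ ?N ?N _ ?N _ ?N])
  qed
  \<comment> \<open>The conditions on the list are settled by \<open>S\<close>, so only the matrix
    equation remains to be compared.\<close>
  have diag_iff: "symplectically_diagonalizes n M T \<longleftrightarrow> transpose_mat T * M * T = D"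
    using assms(8) len \<open>sorted ds\<close> pos
    by (simp add: symplectically_diagonalizes_def williamson_form_def ds_def D_def)
  have dab_prod: "transpose_mat (dab (map f xs)) * dab (map g xs) * dab (map f xs) =
      dab (map (\<lambda>x. transpose_mat (f x) * g x * f x) xs)"
    if f: "\<forall>x \<in> set xs. f x \<in> carrier_mat (2 * m x) (2 * m x)"
      and g: "\<forall>x \<in> set xs. g x \<in> carrier_mat (2 * m x) (2 * m x)"
    for f g :: "nat \<Rightarrow> real mat"
  proof -
    have ft: "\<forall>x \<in> set xs. transpose_mat (f x) \<in> carrier_mat (2 * m x) (2 * m x)"
      using f by simp
    have fg: "\<forall>x \<in> set xs. transpose_mat (f x) * g x \<in> carrier_mat (2 * m x) (2 * m x)"
      using ft g by (blast intro: mult_carrier_mat)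
    show ?thesis
      by (simp only: dab_transpose[where k = m, OF f] dab_mult[where k = m, OF ft g]
          dab_mult[where k = m, OF fg f])
  qed
  show ?thesis
    unfolding diag_iff dab_set_def xs_def[symmetric]
  proof
    assume TMT: "transpose_mat T * M * T = D"
    obtain L where L: "L \<in> carrier_mat ?N ?N" and SL: "S * L = 1\<^sub>m ?N"
      using Sp_inverse[OF assms(6)] by blast
    \<comment> \<open>The equation \<open>T = S * K\<close> forces \<open>K\<close> to be the
      inverse of \<open>S\<close> times \<open>T\<close>.\<close>
    define K where "K = L * T"
    have K: "K \<in> carrier_mat ?N ?N"
      using L T by (auto simp: K_def)
    have "S * K = S * L * T"
      unfolding K_def using S L T by (simp add: assoc_mult_mat[of _ ?N ?N _ ?N _ ?N])
    then have TSK: "T = S * K"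
      using SL T by simp
    have KJ: "transpose_mat K * ?J * K = ?J"
      using congr[OF K J] TJ SJ TSK by simp
    have KD: "transpose_mat K * double_diag ds * K = double_diag ds"
      using congr[OF K M] TMT SMS TSK by (simp add: D_def)
    have KSp: "K \<in> Sp n"
      using K KJ by (simp add: Sp_def)
    note struct = Sp_congruence_double_diag[OF KSp len pos KD]
    obtain f where f: "\<forall>x \<in> set xs. f x \<in> carrier_mat (2 * m x) (2 * m x)"
      and Kf: "K = dab (map f xs)"
    proof (rule dab_of_zero_pattern[of d xs ds m K])
      show "distinct (map d xs)"
        using sd by (simp add: strict_sorted_iff)
    qed (use ds K struct(2) len in auto)
    have ft: "\<forall>x \<in> set xs. transpose_mat (f x) \<in> carrier_mat (2 * m x) (2 * m x)"
      using f by simp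
    \<comment> \<open>Injectivity of \<open>dab\<close> splits \<open>K\<^sup>T J K = J\<close> and
      \<open>K\<^sup>T K = 1\<close> into the same identities for each block.\<close>
    have "f x \<in> OrSp (m x)" if x: "x \<in> set xs" for x
    proof -
      have "transpose_mat (f x) * symplectic_form (m x) * f x = symplectic_form (m x)"
      proof (rule dab_inject[of xs "\<lambda>x. transpose_mat (f x) * symplectic_form (m x) * f x" m, OF _ _ _ x])
        show "dab (map (\<lambda>x. transpose_mat (f x) * symplectic_form (m x) * f x) xs) =
            dab (map (\<lambda>x. symplectic_form (m x)) xs)"
          using KJ dab_prod[OF f, of "\<lambda>x. symplectic_form (m x)"]
          by (simp add: Kf Jdab symplectic_form_carrier)
      qed (use f ft symplectic_form_carrier in \<open>auto intro!: mult_carrier_mat\<close>)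
      moreover have "transpose_mat (f x) * f x = 1\<^sub>m (2 * m x)"
      proof (rule dab_inject[of xs "\<lambda>x. transpose_mat (f x) * f x" m, OF _ _ _ x])
        show "dab (map (\<lambda>x. transpose_mat (f x) * f x) xs) = dab (map (\<lambda>x. 1\<^sub>m (2 * m x)) xs)"
          using struct(1) dab_transpose[where k = m, OF f] dab_mult[where k = m, OF ft f]
          by (simp add: Kf dab_one sum)
      qed (use f ft in \<open>auto intro!: mult_carrier_mat\<close>)
      ultimately show ?thesis
        using f x by (simp add: OrSp_def Sp_def)
    qed
    then have "map f xs \<in> listset (map (\<lambda>i. OrSp (m i)) xs)"
      unfolding listset_map[OF dxs(1)] by blast
    then show "\<exists>K \<in> dab ` listset (map (\<lambda>i. OrSp (m i)) xs). T = S * K"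
      using TSK Kf by blast
  next
    assume "\<exists>K \<in> dab ` listset (map (\<lambda>i. OrSp (m i)) xs). T = S * K"
    then obtain f where TSK: "T = S * dab (map f xs)" and fO: "\<forall>x \<in> set xs. f x \<in> OrSp (m x)"
      by (auto simp: listset_map[OF dxs(1)])
    let ?K = "dab (map f xs)"
    have f: "\<forall>x \<in> set xs. f x \<in> carrier_mat (2 * m x) (2 * m x)"
      and o: "\<forall>x \<in> set xs. transpose_mat (f x) * f x = 1\<^sub>m (2 * m x)"
      using fO by (auto simp: OrSp_def Sp_def)
    \<comment> \<open>The scalar \<open>d x\<close> can be pulled out, which leaves
      \<open>d x\<close> times the product of the transposed block and the block.\<close>
    have e: "transpose_mat (f x) * (d x \<cdot>\<^sub>m 1\<^sub>m (2 * m x)) * f x = d x \<cdot>\<^sub>m 1\<^sub>m (2 * m x)"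
      if x: "x \<in> set xs" for x
    proof -
      have ft: "transpose_mat (f x) \<in> carrier_mat (2 * m x) (2 * m x)"
        using f x by simp
      show ?thesis
        using ft f[rule_format, OF x] o[rule_format, OF x] mult_smult_distrib[OF ft, of "1\<^sub>m (2 * m x)" "2 * m x" "d x"]
          mult_smult_assoc_mat[OF ft f[rule_format, OF x]] by simp
    qed
    have KDK: "transpose_mat ?K * D * ?K = D"
      unfolding Ddab by (subst dab_prod) (use f e in \<open>auto intro!: arg_cong[where f = dab]\<close>)
    have K: "?K \<in> carrier_mat ?N ?N"
      using dab_carrier[of xs f m, OF f] by (simp add: sum)
    show "transpose_mat T * M * T = D"
      using congr[OF K M] SMS KDK TSK by simp
  qed
qed

end
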